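(* Let $A\in\mathbb{R}^{n\times n}$ ($n\ge 1$) be a real matrix whose characteristic polynomial $p(x)=\det(xI-A)\in\mathbb{R}[x]$ is square-free, and let $[a,b]\subset\mathbb{R}$ be a closed interval. Let $q(x)=(x-a)(x-b)$. If $$\sigma(H_q(p))=\sigma(H_1(p)),$$ then $A$ has no real eigenvalue in the interval $[a,b]$.
   Context: A polynomial $p\in\mathbb{R}[x]$ is square-free if $\gcd(p,p')=1$. For a square-free polynomial $p\in\mathbb{R}[x]$ of degree $n\ge 1$ with (distinct) complex roots $z_1,\dots,z_n$ and for $q\in\mathbb{R}[x]$, the Hermite matrix of $p$ with respect to $q$ is the $n\times n$ matrix $H_q(p)=V^T D_q V$, where $V=[z_i^{\,j-1}]_{i,j=1}^n$ is the Vandermonde matrix and $D_q=\mathrm{diag}(q(z_1),\dots,q(z_n))$; equivalently $[H_q(p)]_{i,j}=\sum_{k=1}^n z_k^{\,i+j-2}q(z_k)$. It is a real symmetric matrix. $H_1(p)$ denotes the case of the constant polynomial $q=1$. The signature $\sigma(S)$ of a real symmetric matrix $S$ is the number of positive eigenvalues minus the number of negative eigenvalues of $S$, counted with multiplicity. *)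

theory Defs
  imports
    "Jordan_Normal_Form.Char_Poly"
    "HOL-Computational_Algebra.Field_as_Ring"
begin

abbreviation cpoly :: "real poly \<Rightarrow> complex poly" where
  "cpoly \<equiv> map_poly complex_of_real"

text \<open>
  The enumeration of the distinct complex roots is chosen arbitrarily;
  \<open>hermite_mat_eqI\<close> shows that the Hermite matrix does not depend on the choice, and
  \<open>length_croots\<close> that their number is the degree if the polynomial is square-free. Lists and matrices
  are indexed from 0, so the exponent of the \<open>j\<close>-th column of the Vandermonde matrix is \<open>j\<close>.
\<close>

definition croots :: "real poly \<Rightarrow> complex list" where
  "croots p = (SOME zs. distinct zs \<and> set zs = {z. poly (cpoly p) z = 0})"

definition vandermonde_mat :: "complex list \<Rightarrow> complex mat" where
  "vandermonde_mat zs = mat (length zs) (length zs) (\<lambda>(i, j). (zs ! i) ^ j)"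

definition hermite_cmat :: "complex list \<Rightarrow> real poly \<Rightarrow> complex mat" where
  "hermite_cmat zs q =
     (vandermonde_mat zs)\<^sup>T * mat_diag (length zs) (\<lambda>k. poly (cpoly q) (zs ! k)) *
     vandermonde_mat zs"

text \<open>
  The product has real entries (\<open>of_real_hermite_mat\<close>); \<open>Re\<close> only moves it to the type of real
  matrices.
\<close>

definition hermite_mat :: "real poly \<Rightarrow> real poly \<Rightarrow> real mat" where
  "hermite_mat q p = map_mat Re (hermite_cmat (croots p) q)"

text \<open>
  Eigenvalues are counted with algebraic multiplicity, which agrees with the geometric one for
  the real symmetric matrices to which this is applied.
\<close>

definition signature :: "real mat \<Rightarrow> int" where
  "signature S =
     (\<Sum>x | eigenvalue S x \<and> x > 0. int (order x (char_poly S))) -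
     (\<Sum>x | eigenvalue S x \<and> x < 0. int (order x (char_poly S)))"

lemma cpoly_cnj: "poly (cpoly p) (cnj z) = cnj (poly (cpoly p) z)"
  by (induction p) (auto simp: map_poly_pCons)

lemma cpoly_eq_0_iff: "cpoly p = 0 \<longleftrightarrow> p = 0"
  by (simp add: map_poly_eq_0_iff)

lemma croots:
  assumes "p \<noteq> 0"
  shows "distinct (croots p)" "set (croots p) = {z. poly (cpoly p) z = 0}"
proof -
  have "finite {z. poly (cpoly p) z = 0}"
    using assms by (intro poly_roots_finite) (simp add: cpoly_eq_0_iff)
  then have "\<exists>zs. distinct zs \<and> set zs = {z. poly (cpoly p) z = 0}"
    using finite_distinct_list by blast
  from someI_ex[OF this] show "distinct (croots p)" "set (croots p) = {z. poly (cpoly p) z = 0}"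
    unfolding croots_def by auto
qed

lemma hermite_cmat_carrier: "hermite_cmat zs q \<in> carrier_mat (length zs) (length zs)"
  by (auto simp: hermite_cmat_def vandermonde_mat_def)

lemma hermite_cmat_index:
  assumes "distinct zs" "i < length zs" "j < length zs"
  shows "hermite_cmat zs q $$ (i, j) = (\<Sum>z\<in>set zs. z ^ (i + j) * poly (cpoly q) z)"
proof -
  let ?n = "length zs" and ?V = "vandermonde_mat zs"
  have V: "?V \<in> carrier_mat ?n ?n" "?V\<^sup>T \<in> carrier_mat ?n ?n"
    by (auto simp: vandermonde_mat_def)
  have "hermite_cmat zs q $$ (i, j) =
      (\<Sum>k<?n. (zs ! k) ^ (i + j) * poly (cpoly q) (zs ! k))"
    unfolding hermite_cmat_def mat_diag_mult_right[OF V(2)] using assms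
    by (auto simp: vandermonde_mat_def scalar_prod_def power_add mult_ac atLeast0LessThan
        intro!: sum.cong)
  also have "\<dots> = (\<Sum>z\<in>set zs. z ^ (i + j) * poly (cpoly q) z)"
    by (rule sum.reindex_bij_betw[OF bij_betw_nth[OF assms(1)]]) auto
  finally show ?thesis .
qed

lemma of_real_hermite_mat:
  assumes "p \<noteq> 0"
  shows "map_mat complex_of_real (hermite_mat q p) = hermite_cmat (croots p) q"
proof (rule eq_matI)
  fix i j
  assume "i < dim_row (hermite_cmat (croots p) q)" "j < dim_col (hermite_cmat (croots p) q)"
  then have ij: "i < length (croots p)" "j < length (croots p)"
    using hermite_cmat_carrier[of "croots p" q] by auto
  let ?s = "\<Sum>z | poly (cpoly p) z = 0. z ^ (i + j) * poly (cpoly q) z"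
  have s: "hermite_cmat (croots p) q $$ (i, j) = ?s"
    using hermite_cmat_index[OF croots(1)[OF assms] ij] croots(2)[OF assms] by simp
  have "cnj ?s = (\<Sum>z | poly (cpoly p) z = 0. cnj z ^ (i + j) * poly (cpoly q) (cnj z))"
    by (simp add: cpoly_cnj)
  also have "\<dots> = ?s"
    by (rule sum.reindex_bij_witness[of _ cnj cnj]) (auto simp: cpoly_cnj)
  finally have "complex_of_real (Re ?s) = ?s"
    using Reals_cnj_iff of_real_Re by blast
  then show "map_mat complex_of_real (hermite_mat q p) $$ (i, j) =
      hermite_cmat (croots p) q $$ (i, j)"
    using ij hermite_cmat_carrier[of "croots p" q] s by (simp add: hermite_mat_def)
qed (auto simp: hermite_mat_def)

lemma hermite_mat_eqI:
  assumes "p \<noteq> 0" "distinct zs" "set zs = {z. poly (cpoly p) z = 0}"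
  shows "map_mat complex_of_real (hermite_mat q p) = hermite_cmat zs q"
proof -
  have len: "length (croots p) = length zs"
    using croots[OF assms(1)] assms(2,3) by (metis distinct_card)
  have "hermite_cmat (croots p) q = hermite_cmat zs q"
    by (rule eq_matI) (use len hermite_cmat_carrier[of zs q]
        hermite_cmat_carrier[of "croots p" q] hermite_cmat_index[OF croots(1)[OF assms(1)]]
        hermite_cmat_index[OF assms(2)] croots(2)[OF assms(1)] assms(3) in auto)
  then show ?thesis using of_real_hermite_mat[OF assms(1)] by simp
qed

lemma hermite_mat_symmetric: "(hermite_mat q p)\<^sup>T = hermite_mat q p"
proof -
  let ?V = "vandermonde_mat (croots p)" and ?n = "length (croots p)"
  let ?D = "mat_diag ?n (\<lambda>k. poly (cpoly q) (croots p ! k))"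
  have V: "?V \<in> carrier_mat ?n ?n" "?V\<^sup>T \<in> carrier_mat ?n ?n"
    by (auto simp: vandermonde_mat_def)
  have D: "?D \<in> carrier_mat ?n ?n" "?D\<^sup>T = ?D"
    by (auto simp: mat_diag_def)
  have "(?V\<^sup>T * ?D * ?V)\<^sup>T = ?V\<^sup>T * (?D * ?V)"
    unfolding transpose_mult[OF mult_carrier_mat[OF V(2) D(1)] V(1)]
      transpose_mult[OF V(2) D(1)] D(2) transpose_transpose ..
  then have "(hermite_cmat (croots p) q)\<^sup>T = hermite_cmat (croots p) q"
    unfolding hermite_cmat_def assoc_mult_mat[OF V(2) D(1) V(1)] .
  then show ?thesis by (metis hermite_mat_def map_mat_transpose)
qed

lemma length_croots:
  assumes "p \<noteq> 0" "gcd p (pderiv p) = 1"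
  shows "length (croots p) = degree p"
proof -
  interpret hom: map_poly_comm_ring_hom complex_of_real ..
  have rs: "rsquarefree (cpoly p)"
    unfolding rsquarefree_roots
  proof (intro allI notI, elim conjE)
    fix z assume z: "poly (cpoly p) z = 0" "poly (pderiv (cpoly p)) z = 0"
    have "cpoly (pderiv p) = pderiv (cpoly p)"
      by (simp add: poly_eq_iff coeff_map_poly coeff_pderiv)
    moreover obtain r s where "r * p + s * pderiv p = 1"
      using bezout_coefficients_fst_snd[of p "pderiv p"] assms(2)
      by auto
    then have "cpoly (r * p + s * pderiv p) = 1" by simp
    ultimately have "poly (cpoly r * cpoly p + cpoly s * pderiv (cpoly p)) z = 1"
      by (simp add: hom.hom_add hom.hom_mult)
    with z show False by simp
  qed
  have "length (croots p) = card {z. poly (cpoly p) z = 0}"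
    using croots[OF assms(1)] by (metis distinct_card)
  also have "\<dots> = degree (cpoly p)"
    using rsquarefree_card_degree[of "cpoly p"] rs assms(1) by (simp add: cpoly_eq_0_iff)
  finally show ?thesis by simp
qed

end

theory Submission
  imports Defs "Jordan_Normal_Form.Schur_Decomposition"
begin

text \<open>
  By Hermite's theorem, the signature of \<open>hermite_mat q p\<close> is the number of real roots of \<open>p\<close> where
  \<open>q\<close> is positive minus the number of those where \<open>q\<close> is negative, so the two signatures agree only
  if \<open>q\<close> is positive at every real root of \<open>p\<close>, whereas \<open>q \<le> 0\<close> on \<open>[a, b]\<close>. Hermite's theorem is
  Sylvester's law of inertia for the form \<open>\<Sum>z. q(z) F(z)\<^sup>2\<close> on polynomials \<open>F\<close> of degree less than
  the number of roots: a real root contributes one real square of sign \<open>sgn (q(z))\<close>, and a conjugate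
  pair contributes \<open>2 Re (q(z) F(z)\<^sup>2) = 2 (u\<^sup>2 - v\<^sup>2)\<close> with \<open>u + i v = \<surd>q(z) F(z)\<close>, hence
  nothing to the signature.
\<close>

section \<open>Orthogonal diagonalization of real symmetric matrices\<close>

lemma nonzero_vec_dim_pos:
  assumes "v \<in> carrier_vec n" "v \<noteq> 0\<^sub>v n"
  shows "n > 0"
proof (rule ccontr)
  assume "\<not> n > 0"
  then have "v = 0\<^sub>v n" using assms(1) by (intro eq_vecI) auto
  with assms(2) show False ..
qed

text \<open>Gram-Schmidt, run on a basis that begins with \<open>v\<close>, leaves its first vector
  unchanged, so only normalization rescales it.\<close>

lemma orthogonal_completion:
  fixes v :: "real vec"
  assumes v: "v \<in> carrier_vec n" "v \<noteq> 0\<^sub>v n"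
  obtains W c where "W \<in> carrier_mat n n" "W\<^sup>T * W = 1\<^sub>m n" "col W 0 = c \<cdot>\<^sub>v v"
proof -
  interpret cof_vec_space n "TYPE(real)" .
  define b where "b = basis_completion v"
  define ws where "ws = gram_schmidt n b"
  note b = basis_completion[OF v, folded b_def]
  have n: "n > 0" using nonzero_vec_dim_pos[OF v] .
  obtain vs where "b = v # vs" using b(6,7) n by (cases b) auto
  then have hd: "hd ws = v" using v by (simp add: ws_def)
  have ws: "set ws \<subseteq> carrier_vec n" "corthogonal ws" "length ws = n"
    using gram_schmidt_result[OF b(2,4,5) refl, folded ws_def] b(6) by auto
  have dim: "dim_vec (ws ! i) = n" if "i < n" for i
    using that ws(1,3) by (metis carrier_vecD nth_mem subsetD)
  \<comment> \<open>Real conjugation is trivial, so \<open>corthogonal\<close> is ordinary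
    orthogonality; the case \<open>i = j\<close> says that no vector has length 0.\<close>
  have orth: "(ws ! i \<bullet> ws ! j = 0) = (i \<noteq> j)" if "i < n" "j < n" for i j
    using corthogonalD[OF ws(2)] that ws(3) by (simp add: conjugate_vec_def vec_eq_iff)
  have pos: "ws ! i \<bullet> ws ! i > 0" if "i < n" for i
    using orth[OF that that] by (simp add: scalar_prod_def sum_nonneg order_less_le)
  define W where "W = mat n n (\<lambda>(i, j). ws ! j $ i / sqrt (ws ! j \<bullet> ws ! j))"
  show ?thesis
  proof
    show W: "W \<in> carrier_mat n n" by (simp add: W_def)
    show "W\<^sup>T * W = 1\<^sub>m n"
    proof (rule eq_matI)
      fix i j assume "i < dim_row (1\<^sub>m n :: real mat)" "j < dim_col (1\<^sub>m n :: real mat)"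
      then have ij: "i < n" "j < n" by auto
      then have "(W\<^sup>T * W) $$ (i, j) =
          (ws ! i \<bullet> ws ! j) / (sqrt (ws ! i \<bullet> ws ! i) * sqrt (ws ! j \<bullet> ws ! j))"
        by (simp add: scalar_prod_def W_def sum_divide_distrib dim)
      then show "(W\<^sup>T * W) $$ (i, j) = 1\<^sub>m n $$ (i, j)"
        using ij orth[OF ij] pos[OF ij(1)] by auto
    qed (use W in auto)
    show "col W 0 = (1 / sqrt (v \<bullet> v)) \<cdot>\<^sub>v v"
      using n hd ws(3) v by (auto simp: W_def hd_conv_nth)
  qed
qed

text \<open>Deflation: in an orthonormal basis that begins with an eigenvector for \<open>e\<close>,
  the matrix splits off a 1 by 1 block, and the rest is handled by induction. The diagonal keeps the
  order of \<open>es\<close>, which ties it to the factorization of the characteristic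
  polynomial.\<close>

theorem real_symmetric_diagonalization:
  fixes S :: "real mat"
  assumes "S \<in> carrier_mat n n" "S\<^sup>T = S" "char_poly S = (\<Prod>e\<leftarrow>es. [:- e, 1:])"
  shows "\<exists>W \<in> carrier_mat n n. W\<^sup>T * W = 1\<^sub>m n \<and> S = W * mat_diag n ((!) es) * W\<^sup>T"
  using assms
proof (induction es arbitrary: n S)
  case Nil
  then have "n = 0" using degree_monic_char_poly[of S n] by simp
  then show ?case using Nil(1) by (intro bexI[of _ "1\<^sub>m 0"]) auto
next
  case (Cons e es)
  note S = Cons.prems(1)
  have "eigenvalue S e" unfolding eigenvalue_root_char_poly[OF S] Cons.prems(3) by simp
  then obtain v where v: "v \<in> carrier_vec n" "v \<noteq> 0\<^sub>v n" "S *\<^sub>v v = e \<cdot>\<^sub>v v"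
    using S by (auto simp: eigenvalue_def eigenvector_def)
  obtain m where n: "n = Suc m" using nonzero_vec_dim_pos[OF v(1,2)] gr0_implies_Suc by blast
  have n0: "0 < n" by (simp add: n)
  obtain W c where W: "W \<in> carrier_mat n n" "W\<^sup>T * W = 1\<^sub>m n" "col W 0 = c \<cdot>\<^sub>v v"
    using orthogonal_completion[OF v(1,2)] .
  have WT: "W\<^sup>T \<in> carrier_mat n n" using W by simp
  have WW: "W * W\<^sup>T = 1\<^sub>m n" using mat_mult_left_right_inverse[OF WT W(1) W(2)] .
  define B where "B = W\<^sup>T * S * W"
  have B: "B \<in> carrier_mat n n" using W S by (simp add: B_def)
  have BT: "B\<^sup>T = B"
    unfolding B_def using W(1) WT S Cons.prems(2)
    by (simp add: transpose_mult[of _ n n _ n] assoc_mult_mat[of _ n n _ n _ n])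
  have SB: "S = W * B * W\<^sup>T"
  proof -
    have "W * B * W\<^sup>T = (W * W\<^sup>T) * S * (W * W\<^sup>T)"
      unfolding B_def using W(1) WT S by (simp add: assoc_mult_mat[of _ n n _ n _ n])
    then show ?thesis using WW S by simp
  qed
  have "col B 0 = W\<^sup>T *\<^sub>v (S *\<^sub>v col W 0)"
    unfolding B_def assoc_mult_mat[OF WT S W(1)] col_mult2[OF WT mult_carrier_mat[OF S W(1)] n0]
      col_mult2[OF S W(1) n0] ..
  also have "S *\<^sub>v col W 0 = e \<cdot>\<^sub>v col W 0"
    using v S by (simp add: W(3) mult_mat_vec[of _ n n] smult_smult_assoc mult.commute)
  also have "W\<^sup>T *\<^sub>v (e \<cdot>\<^sub>v col W 0) = e \<cdot>\<^sub>v col (W\<^sup>T * W) 0"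
    using W(1) unfolding col_mult2[OF WT W(1) n0] by (intro mult_mat_vec[OF WT] carrier_vecI) simp
  finally have B0: "B $$ (i, 0) = (if i = 0 then e else 0)" if "i < n" for i
    using that B n0 W(1,2) by (auto simp: vec_eq_iff)
  \<comment> \<open>Symmetry carries the zeros of the first column over to the first row.\<close>
  have B0': "B $$ (0, j) = (if j = 0 then e else 0)" if "j < n" for j
    using B0[OF that] BT B n that by (metis carrier_matD index_transpose_mat(1) zero_less_Suc)
  define C where "C = mat m m (\<lambda>(i, j). B $$ (Suc i, Suc j))"
  define E where "E = mat 1 1 (\<lambda>_. e)"
  have C: "C \<in> carrier_mat m m" and E: "E \<in> carrier_mat 1 1" by (auto simp: C_def E_def)
  have BC: "B = four_block_mat E (0\<^sub>m 1 m) (0\<^sub>m m 1) C"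
    by (rule eq_matI) (use B n B0 B0' in \<open>auto simp: C_def E_def\<close>)
  have CT: "C\<^sup>T = C"
    by (rule eq_matI) (use BT B n in \<open>auto simp: C_def mat_eq_iff\<close>)
  \<comment> \<open>Cancelling the factor of \<open>e\<close> in the characteristic polynomial of
    the block matrix leaves the factorization of \<open>char_poly C\<close> that the induction
    hypothesis asks for.\<close>
  have "similar_mat_wit S B W (W\<^sup>T)"
    by (rule similar_mat_witI[of _ _ n]) (use W WW WT S B SB in auto)
  then have "char_poly S = char_poly B"
    by (intro char_poly_similar) (auto simp: similar_mat_def)
  also have "\<dots> = char_poly E * char_poly C"
    unfolding BC by (rule char_poly_four_block_zeros_col[OF E _ C]) simp
  also have "char_poly E = [:- e, 1:]"
    by (simp add: E_def char_poly_defs det_def sign_def)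
  finally have "char_poly C = (\<Prod>e\<leftarrow>es. [:- e, 1:])"
    using Cons.prems(3) by (simp del: mult_pCons_left)
  from Cons.IH[OF C CT this] obtain X where
    X: "X \<in> carrier_mat m m" "X\<^sup>T * X = 1\<^sub>m m" "C = X * mat_diag m ((!) es) * X\<^sup>T" by blast
  \<comment> \<open>\<open>Y\<close> fixes the first basis vector and acts as \<open>X\<close> on
    the others; \<open>W * Y\<close> then diagonalizes \<open>S\<close>.\<close>
  define Y where "Y = four_block_mat (1\<^sub>m 1) (0\<^sub>m 1 m) (0\<^sub>m m 1) X"
  define D where "D = mat_diag n ((!) (e # es))"
  have D: "D = four_block_mat E (0\<^sub>m 1 m) (0\<^sub>m m 1) (mat_diag m ((!) es))" "D \<in> carrier_mat n n"
    unfolding D_def n by (rule eq_matI) (auto simp: mat_diag_def E_def nth_Cons')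
  have Y: "Y \<in> carrier_mat n n" using X(1) four_block_carrier_mat[of "1\<^sub>m 1" 1 1 X m m]
    by (simp add: n Y_def)
  have YT: "Y\<^sup>T = four_block_mat (1\<^sub>m 1) (0\<^sub>m 1 m) (0\<^sub>m m 1) (X\<^sup>T)"
    unfolding Y_def using X(1)
    by (subst transpose_four_block_mat[of _ 1 1 _ m _ m]) auto
  have YY: "Y\<^sup>T * Y = 1\<^sub>m n"
    unfolding YT unfolding Y_def using X
    by (subst mult_four_block_mat[of _ 1 1 _ m _ m _ _ 1 _ m]) (auto simp: n four_block_one_mat)
  have BY: "B = Y * D * Y\<^sup>T"
  proof -
    let ?D = "mat_diag m ((!) es)"
    have XD: "X * ?D \<in> carrier_mat m m" using X(1) by simp
    have "Y * D = four_block_mat E (0\<^sub>m 1 m) (0\<^sub>m m 1) (X * ?D)"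
      unfolding D(1) Y_def using X(1) E
      by (subst mult_four_block_mat[of _ 1 1 _ m _ m _ _ 1 _ m])
        (auto simp: left_mult_zero_mat[of _ m m] right_mult_zero_mat[of _ m m])
    then have "Y * D * Y\<^sup>T = four_block_mat E (0\<^sub>m 1 m) (0\<^sub>m m 1) (X * ?D * X\<^sup>T)"
      unfolding YT using X(1) E XD
      by (simp del: One_nat_def, subst mult_four_block_mat[of _ 1 1 _ m _ m _ _ 1 _ m])
        (auto simp: left_mult_zero_mat[of _ m m] right_mult_zero_mat[of _ m m])
    then show ?thesis unfolding BC using X(3) by simp
  qed
  show ?case
  proof (intro bexI[of _ "W * Y"] conjI)
    have YT': "Y\<^sup>T \<in> carrier_mat n n" using Y by simp
    have T: "(W * Y)\<^sup>T = Y\<^sup>T * W\<^sup>T" using transpose_mult[OF W(1) Y] .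
    have "(W * Y)\<^sup>T * (W * Y) = Y\<^sup>T * ((W\<^sup>T * W) * Y)"
      unfolding T using W(1) WT Y YT' by (simp add: assoc_mult_mat[of _ n n _ n _ n])
    then show "(W * Y)\<^sup>T * (W * Y) = 1\<^sub>m n" using Y YY W(2) by simp
    show "S = W * Y * mat_diag n ((!) (e # es)) * (W * Y)\<^sup>T"
      unfolding T D_def[symmetric] SB BY
      using W(1) WT Y YT' D(2) by (simp add: assoc_mult_mat[of _ n n _ n _ n])
  qed (use W Y in auto)
qed

section \<open>Sylvester's law of inertia\<close>

lemma underdetermined_nontrivial_solution:
  fixes f :: "'i \<Rightarrow> 'a :: field vec"
  assumes "finite I" "card I < n" "\<And>i. i \<in> I \<Longrightarrow> f i \<in> carrier_vec n"
  obtains x where "x \<in> carrier_vec n" "x \<noteq> 0\<^sub>v n" "\<And>i. i \<in> I \<Longrightarrow> f i \<bullet> x = 0"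
proof -
  obtain h where h: "bij_betw h {0..<card I} I" using ex_bij_betw_nat_finite[OF assms(1)] by blast
  define c where "c = (\<lambda>k. if k < card I then f (h k) else 0\<^sub>v n)"
  \<comment> \<open>The equations are padded with zero rows to a square matrix. Row
    \<open>card I\<close> is certainly zero, so the determinant vanishes.\<close>
  define M where "M = mat\<^sub>r n n (\<lambda>k. if k = card I then 0\<^sub>v n else c k)"
  have c: "c k \<in> carrier_vec n" for k
    using bij_betwE[OF h] assms(3) by (simp add: c_def)
  have M: "M \<in> carrier_mat n n" by (simp add: M_def)
  have "det M = 0" unfolding M_def by (rule det_row_0[OF assms(2)]) (use c in auto)
  then obtain x where x: "x \<in> carrier_vec n" "x \<noteq> 0\<^sub>v n" "M *\<^sub>v x = 0\<^sub>v n"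
    using det_0_iff_vec_prod_zero_field[OF M] by auto
  show ?thesis
  proof (rule that[OF x(1,2)])
    fix i assume "i \<in> I"
    then obtain k where k: "k < card I" "i = h k" using h unfolding bij_betw_def by (metis atLeastLessThan_iff imageE)
    have "row M k = f i" using k assms(2) c[of k] by (simp add: M_def c_def)
    moreover have "row M k \<bullet> x = (M *\<^sub>v x) $ k" using M k assms(2) by simp
    ultimately show "f i \<bullet> x = 0" using x(3) k assms(2) by simp
  qed
qed

text \<open>One inequality of the law of inertia, by counting dimensions. Swapping the two forms and
  negating the coefficients gives the other inequalities.\<close>

lemma inertia_le:
  fixes f :: "'i \<Rightarrow> real vec" and g :: "'j \<Rightarrow> real vec"
  assumes fin: "finite I" "finite J" and card: "card J = n"
    and f: "\<And>i. i \<in> I \<Longrightarrow> f i \<in> carrier_vec n" and g: "\<And>j. j \<in> J \<Longrightarrow> g j \<in> carrier_vec n"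
    and eq: "\<And>x. x \<in> carrier_vec n \<Longrightarrow>
      (\<Sum>i\<in>I. a i * (f i \<bullet> x)\<^sup>2) = (\<Sum>j\<in>J. b j * (g j \<bullet> x)\<^sup>2)"
    and inj: "\<And>x. x \<in> carrier_vec n \<Longrightarrow> (\<And>j. j \<in> J \<Longrightarrow> g j \<bullet> x = 0) \<Longrightarrow> x = 0\<^sub>v n"
  shows "card {j \<in> J. b j < 0} \<le> card {i \<in> I. a i < 0}"
proof (rule ccontr)
  assume less: "\<not> ?thesis"
  \<comment> \<open>\<open>K\<close> indexes fewer than \<open>n\<close> linear equations; at a nonzero solution the left form is \<open>\<ge> 0\<close>
    and the right one \<open>\<le> 0\<close>, so both vanish.\<close>
  define K where "K = {i \<in> I. a i < 0} <+> {j \<in> J. \<not> b j < 0}"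
  have "card J = card ({j \<in> J. b j < 0} \<union> {j \<in> J. \<not> b j < 0})"
    by (rule arg_cong[of _ _ card]) auto
  also have "\<dots> = card {j \<in> J. b j < 0} + card {j \<in> J. \<not> b j < 0}"
    by (rule card_Un_disjoint) (use fin in auto)
  finally have K: "finite K" "card K < n"
    using fin card less by (auto simp: K_def card_Plus)
  obtain x where x: "x \<in> carrier_vec n" "x \<noteq> 0\<^sub>v n"
    and Kx: "\<And>k. k \<in> K \<Longrightarrow> case_sum f g k \<bullet> x = 0"
    by (rule underdetermined_nontrivial_solution[OF K, of "case_sum f g"])
      (use f g in \<open>auto simp: K_def\<close>)
  have fx: "f i \<bullet> x = 0" if "i \<in> I" "a i < 0" for i
    using Kx[of "Inl i"] that by (auto simp: K_def)
  have gx: "g j \<bullet> x = 0" if "j \<in> J" "\<not> b j < 0" for j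
    using Kx[of "Inr j"] that by (auto simp: K_def)
  have neg: "0 \<le> - b j * (g j \<bullet> x)\<^sup>2" if "j \<in> J" for j
    using gx[OF that] by (cases "b j < 0") (auto simp: mult_nonpos_nonneg)
  have "0 \<le> a i * (f i \<bullet> x)\<^sup>2" if "i \<in> I" for i
    using fx[OF that] by (cases "a i < 0") auto
  then have "0 \<le> (\<Sum>i\<in>I. a i * (f i \<bullet> x)\<^sup>2)" by (rule sum_nonneg)
  then have "(\<Sum>j\<in>J. - b j * (g j \<bullet> x)\<^sup>2) \<le> 0"
    using eq[OF x(1)] by (simp add: sum_negf)
  then have "(\<Sum>j\<in>J. - b j * (g j \<bullet> x)\<^sup>2) = 0"
    using neg by (intro antisym sum_nonneg)
  \<comment> \<open>No term is negative, so each one vanishes. This gives the equations for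
    \<open>b j < 0\<close>, while those for the other \<open>j\<close> were imposed through
    \<open>K\<close>.\<close>
  then have "\<forall>j\<in>J. - b j * (g j \<bullet> x)\<^sup>2 = 0"
    by (subst (asm) sum_nonneg_eq_0_iff) (use fin(2) neg in auto)
  then have "g j \<bullet> x = 0" if "j \<in> J" for j
    using that gx by (cases "b j < 0") auto
  then show False using inj[OF x(1)] x(2) by blast
qed

section \<open>Real spectrum and signature\<close>

lemma real_symmetric_char_poly_splits:
  fixes S :: "real mat"
  assumes S: "S \<in> carrier_mat n n" "S\<^sup>T = S"
  shows "\<exists>es. char_poly S = (\<Prod>e\<leftarrow>es. [:- e, 1:]) \<and> length es = n"
proof -
  let ?C = "map_mat complex_of_real S"
  have C: "?C \<in> carrier_mat n n" "?C\<^sup>T = ?C"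
    using S by (auto simp: map_mat_transpose)
  interpret hom: map_poly_inj_comm_ring_hom complex_of_real ..
  have cp: "char_poly ?C = cpoly (char_poly S)" using of_real_hom.char_poly_hom[OF S(1)] .
  obtain as where as: "char_poly ?C = (\<Prod>a\<leftarrow>as. [:- a, 1:])" "length as = n"
    using char_poly_factorized[OF C(1)] by blast
  have real: "complex_of_real (Re a) = a" if "a \<in> set as" for a
  proof -
    have "poly (char_poly ?C) a = 0"
      using that by (simp add: as(1) poly_prod_list prod_list_zero_iff image_iff)
    then obtain v where v: "v \<in> carrier_vec n" "v \<noteq> 0\<^sub>v n" "?C *\<^sub>v v = a \<cdot>\<^sub>v v"
      using eigenvalue_root_char_poly[OF C(1)] C(1) by (auto simp: eigenvalue_def eigenvector_def)
    have cv: "conjugate v \<in> carrier_vec n" using v(1) by simp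
    have "conjugate (?C *\<^sub>v v) = ?C *\<^sub>v conjugate v"
      by (rule eq_vecI) (use S(1) v(1) in \<open>auto simp: scalar_prod_def\<close>)
    then have *: "?C *\<^sub>v conjugate v = cnj a \<cdot>\<^sub>v conjugate v"
      using v(3) by (simp add: conjugate_smult_vec)
    \<comment> \<open>Moving the symmetric matrix from one factor to the other turns
      \<open>a\<close> into \<open>cnj a\<close>, and the product of \<open>v\<close> with its
      conjugate is nonzero.\<close>
    have "a * (v \<bullet>c v) = (?C\<^sup>T *\<^sub>v v) \<bullet>c v"
      using v cv C by simp
    also have "\<dots> = v \<bullet> (?C *\<^sub>v conjugate v)"
      by (rule transpose_vec_mult_scalar[OF C(1) cv v(1)])
    also have "\<dots> = cnj a * (v \<bullet>c v)"
      using v cv by (simp add: *)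
    finally have "cnj a = a"
      using v(2) conjugate_square_eq_0_vec[OF v(1)] by auto
    then show ?thesis by (metis Reals_cnj_iff of_real_Re)
  qed
  \<comment> \<open>All roots being real, the complex factorization is the image of a real one, and
    injectivity of \<open>cpoly\<close> brings it back.\<close>
  have "cpoly (\<Prod>e\<leftarrow>map Re as. [:- e, 1:]) = (\<Prod>a\<leftarrow>as. [:- complex_of_real (Re a), 1:])"
    by (simp add: hom.hom_prod_list o_def)
  also have "\<dots> = cpoly (char_poly S)"
    unfolding cp[symmetric] as(1) using real by (metis (mono_tags, lifting) map_cong)
  finally have "char_poly S = (\<Prod>e\<leftarrow>map Re as. [:- e, 1:])" by (metis hom.injectivity)
  then show ?thesis using as(2) by (metis length_map)
qed

text \<open>Translates the multiplicities in \<open>signature\<close> into a count of positions in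
  \<open>es\<close>: distinct eigenvalues occupy disjoint sets of positions.\<close>

lemma sum_order_char_poly:
  fixes S :: "real mat"
  assumes S: "S \<in> carrier_mat n n" and cp: "char_poly S = (\<Prod>e\<leftarrow>es. [:- e, 1:])"
  shows "(\<Sum>x | eigenvalue S x \<and> P x. Polynomial.order x (char_poly S)) = card {k. k < length es \<and> P (es ! k)}"
proof -
  have ev: "eigenvalue S x \<longleftrightarrow> x \<in> set es" for x
    by (simp add: eigenvalue_root_char_poly[OF S] cp poly_prod_list prod_list_zero_iff image_iff)
  have ord: "Polynomial.order x (char_poly S) = card {k. k < length es \<and> es ! k = x}" for x
  proof -
    have "Polynomial.order x (char_poly S) = (\<Sum>e\<leftarrow>es. if e = x then 1 else 0)"
      unfolding cp by (subst order_prod_list) (auto simp: o_def order_linear' intro!: arg_cong[of _ _ sum_list])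
    also have "\<dots> = (\<Sum>k<length es. if es ! k = x then 1 else 0)"
      by (simp add: sum_list_sum_nth atLeast0LessThan)
    also have "\<dots> = card {k. k < length es \<and> es ! k = x}"
      by (simp add: sum.If_cases Int_def)
    finally show ?thesis .
  qed
  have "(\<Sum>x | eigenvalue S x \<and> P x. Polynomial.order x (char_poly S)) =
      card (\<Union>x\<in>{x. x \<in> set es \<and> P x}. {k. k < length es \<and> es ! k = x})"
    unfolding ord ev by (rule card_UN_disjoint[symmetric]) auto
  also have "(\<Union>x\<in>{x. x \<in> set es \<and> P x}. {k. k < length es \<and> es ! k = x}) =
      {k. k < length es \<and> P (es ! k)}" by auto
  finally show ?thesis .
qed

text \<open>Any expression of the form by \<open>n\<close> squares with trivial common kernel is
  compared with the one from the spectral decomposition, whose coefficients are the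
  eigenvalues.\<close>

theorem signature_quadratic_form:
  fixes S :: "real mat" and f :: "'i \<Rightarrow> real vec"
  assumes S: "S \<in> carrier_mat n n" "S\<^sup>T = S"
    and I: "finite I" "card I = n"
    and f: "\<And>i. i \<in> I \<Longrightarrow> f i \<in> carrier_vec n"
    and inj: "\<And>x. x \<in> carrier_vec n \<Longrightarrow> (\<And>i. i \<in> I \<Longrightarrow> f i \<bullet> x = 0) \<Longrightarrow> x = 0\<^sub>v n"
    and form: "\<And>x. x \<in> carrier_vec n \<Longrightarrow> x \<bullet> (S *\<^sub>v x) = (\<Sum>i\<in>I. a i * (f i \<bullet> x)\<^sup>2)"
  shows "signature S = int (card {i \<in> I. a i > 0}) - int (card {i \<in> I. a i < 0})"
proof -
  obtain es where es: "char_poly S = (\<Prod>e\<leftarrow>es. [:- e, 1:])" "length es = n"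
    using real_symmetric_char_poly_splits[OF S] by blast
  obtain W where W: "W \<in> carrier_mat n n" "W\<^sup>T * W = 1\<^sub>m n" "S = W * mat_diag n ((!) es) * W\<^sup>T"
    using real_symmetric_diagonalization[OF S es(1)] by blast
  have WT: "W\<^sup>T \<in> carrier_mat n n" using W by simp
  have WW: "W * W\<^sup>T = 1\<^sub>m n" using mat_mult_left_right_inverse[OF WT W(1) W(2)] .
  have eq: "(\<Sum>i\<in>I. a i * (f i \<bullet> x)\<^sup>2) = (\<Sum>k<n. es ! k * (col W k \<bullet> x)\<^sup>2)"
    if x: "x \<in> carrier_vec n" for x
  proof -
    let ?y = "W\<^sup>T *\<^sub>v x" and ?D = "mat_diag n ((!) es)"
    have y: "?y \<in> carrier_vec n" using WT x by (rule mult_mat_vec_carrier)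
    have "x \<bullet> (S *\<^sub>v x) = x \<bullet> (W *\<^sub>v (?D *\<^sub>v ?y))"
      unfolding W(3) using W(1) WT x by (simp add: assoc_mult_mat_vec[of _ n n _ n])
    also have "\<dots> = ?y \<bullet> (?D *\<^sub>v ?y)"
      by (rule transpose_vec_mult_scalar[symmetric, OF W(1) _ x]) (simp add: mult_mat_vec_carrier[of _ n n] y)
    also have "?D *\<^sub>v ?y = vec n (\<lambda>k. es ! k * ?y $ k)"
    proof (rule eq_vecI)
      fix k assume "k < dim_vec (vec n (\<lambda>k. es ! k * ?y $ k))"
      then have k: "k < n" by simp
      have "(?D *\<^sub>v ?y) $ k = (\<Sum>l<n. (if k = l then es ! l else 0) * ?y $ l)"
        using k y W(1) by (simp add: scalar_prod_def mat_diag_def atLeast0LessThan)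
      also have "\<dots> = (\<Sum>l<n. if k = l then es ! l * ?y $ l else 0)"
        by (rule sum.cong) auto
      finally show "(?D *\<^sub>v ?y) $ k = vec n (\<lambda>k. es ! k * ?y $ k) $ k"
        using k by simp
    qed (simp add: mat_diag_def)
    also have "?y \<bullet> vec n (\<lambda>k. es ! k * ?y $ k) = (\<Sum>k<n. es ! k * (?y $ k)\<^sup>2)"
      by (simp add: scalar_prod_def[of ?y] atLeast0LessThan power2_eq_square mult_ac)
    also have "\<dots> = (\<Sum>k<n. es ! k * (col W k \<bullet> x)\<^sup>2)"
      using W(1) by (intro sum.cong) auto
    finally show ?thesis using form[OF x] by simp
  qed
  have injW: "x = 0\<^sub>v n" if x: "x \<in> carrier_vec n" "\<And>k. k \<in> {..<n} \<Longrightarrow> col W k \<bullet> x = 0" for x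
  proof -
    have "W\<^sup>T *\<^sub>v x = 0\<^sub>v n" by (rule eq_vecI) (use W(1) x in auto)
    then have "(W * W\<^sup>T) *\<^sub>v x = W *\<^sub>v 0\<^sub>v n"
      using W(1) WT x by (simp add: assoc_mult_mat_vec[of _ n n _ n])
    then show ?thesis using WW W(1) x(1) by auto
  qed
  have colW: "col W k \<in> carrier_vec n" if "k \<in> {..<n}" for k
    using W(1) by (intro carrier_vecI) simp
  \<comment> \<open>Negating both forms turns positive coefficients into negative ones, which
    \<open>inertia_le\<close> can count.\<close>
  have nsum: "(\<Sum>i\<in>I. - a i * (f i \<bullet> x)\<^sup>2) = (\<Sum>k\<in>{..<n}. - (es ! k) * (col W k \<bullet> x)\<^sup>2)"
    if "x \<in> carrier_vec n" for x
    using eq[OF that] by (simp add: sum_negf)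
  have "card {k \<in> {..<n}. es ! k < 0} = card {i \<in> I. a i < 0}"
  proof (rule antisym)
    show "card {k \<in> {..<n}. es ! k < 0} \<le> card {i \<in> I. a i < 0}"
      by (rule inertia_le[OF I(1) finite_lessThan card_lessThan f colW eq injW]; blast)
    show "card {i \<in> I. a i < 0} \<le> card {k \<in> {..<n}. es ! k < 0}"
      by (rule inertia_le[OF finite_lessThan I colW f eq[symmetric] inj]; blast)
  qed
  moreover have "card {k \<in> {..<n}. - (es ! k) < 0} = card {i \<in> I. - a i < 0}"
  proof (rule antisym)
    show "card {k \<in> {..<n}. - (es ! k) < 0} \<le> card {i \<in> I. - a i < 0}"
      by (rule inertia_le[OF I(1) finite_lessThan card_lessThan f colW nsum injW]; blast)
    show "card {i \<in> I. - a i < 0} \<le> card {k \<in> {..<n}. - (es ! k) < 0}"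
      by (rule inertia_le[OF finite_lessThan I colW f nsum[symmetric] inj]; blast)
  qed
  ultimately show ?thesis
    using sum_order_char_poly[OF S(1) es(1), of "\<lambda>x. x > 0"]
      sum_order_char_poly[OF S(1) es(1), of "\<lambda>x. x < 0"] es(2)
    by (simp add: signature_def flip: of_nat_sum)
qed

section \<open>Hermite's root counting theorem\<close>

lemma poly_cpoly_of_real: "poly (cpoly p) (complex_of_real x) = complex_of_real (poly p x)"
  by (induction p) (auto simp: map_poly_pCons)

theorem signature_hermite_mat:
  assumes p: "p \<noteq> 0"
  shows "signature (hermite_mat q p) =
    int (card {x. poly p x = 0 \<and> poly q x > 0}) - int (card {x. poly p x = 0 \<and> poly q x < 0})"
proof -
  define Z where "Z = {z. poly (cpoly p) z = 0}"
  define N where "N = length (croots p)"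
  define S where "S = hermite_mat q p"
  define Q where "Q = poly (cpoly q)"
  have Z: "Z = set (croots p)" using croots(2)[OF p] by (simp add: Z_def)
  then have finZ: "finite Z" and cardZ: "card Z = N"
    using distinct_card[OF croots(1)[OF p]] by (simp_all add: N_def)
  have cnjZ: "cnj z \<in> Z \<longleftrightarrow> z \<in> Z" for z by (simp add: Z_def cpoly_cnj)
  have S: "S \<in> carrier_mat N N" "S\<^sup>T = S"
    using hermite_cmat_carrier[of "croots p" q]
    by (simp_all add: S_def N_def hermite_mat_def hermite_mat_symmetric[unfolded hermite_mat_def])
  have Sij: "complex_of_real (S $$ (i, j)) = (\<Sum>z\<in>Z. z ^ (i + j) * Q z)" if "i < N" "j < N" for i j
  proof -
    have "complex_of_real (S $$ (i, j)) = hermite_cmat (croots p) q $$ (i, j)"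
      using S(1) that by (simp add: S_def flip: of_real_hermite_mat[OF p])
    then show ?thesis
      using hermite_cmat_index[OF croots(1)[OF p]] that by (simp add: N_def Z Q_def)
  qed
  \<comment> \<open>The value at \<open>z\<close> of the real polynomial with coefficient vector
    \<open>x\<close>.\<close>
  define F where "F = (\<lambda>x z. \<Sum>j<N. z ^ j * complex_of_real (x $ j))"
  have Fcnj: "F x (cnj z) = cnj (F x z)" for x z by (simp add: F_def)
  have Qcnj: "Q (cnj z) = cnj (Q z)" for z by (simp add: Q_def cpoly_cnj)
  \<comment> \<open>The sum of the complex terms over \<open>Z\<close> is real, so taking real parts
    termwise loses nothing.\<close>
  define h where "h = (\<lambda>x z. Re (Q z * (F x z)\<^sup>2))"
  have form: "x \<bullet> (S *\<^sub>v x) = (\<Sum>z\<in>Z. h x z)" if x: "x \<in> carrier_vec N" for x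
  proof -
    have "x \<bullet> (S *\<^sub>v x) = (\<Sum>i<N. \<Sum>j<N. x $ i * S $$ (i, j) * x $ j)"
      using S(1) x by (simp add: scalar_prod_def atLeast0LessThan sum_distrib_left mult.assoc)
    then have "complex_of_real (x \<bullet> (S *\<^sub>v x)) =
        (\<Sum>i<N. \<Sum>j<N. \<Sum>z\<in>Z. Q z * (z ^ i * of_real (x $ i) * (z ^ j * of_real (x $ j))))"
      by (simp add: Sij sum_distrib_left sum_distrib_right power_add mult_ac)
    also have "\<dots> = (\<Sum>z\<in>Z. \<Sum>i<N. \<Sum>j<N. Q z * (z ^ i * of_real (x $ i) * (z ^ j * of_real (x $ j))))"
      by (simp only: sum.swap[where A = "{..<N}" and B = Z])
    also have "\<dots> = (\<Sum>z\<in>Z. Q z * (F x z)\<^sup>2)"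
      by (simp only: F_def power2_eq_square sum_product) (simp only: sum_distrib_left)
    finally show ?thesis unfolding h_def by (metis Re_complex_of_real Re_sum)
  qed
  \<comment> \<open>At real roots the sign of \<open>Q z\<close> goes into \<open>c\<close> instead.
    Where \<open>Q z = 0\<close>, the value 1 keeps \<open>w\<close> nonzero, so that the linear
    forms still determine \<open>x\<close>.\<close>
  define w where "w = (\<lambda>z. if Im z = 0 \<or> Q z = 0 then 1 else csqrt (Q z))"
  \<comment> \<open>In a conjugate pair with \<open>Q z\<close> nonzero, the upper root carries the
    square of the real part with weight 2, the lower root that of the imaginary part with weight
    -2.\<close>
  define c where "c = (\<lambda>z. if Im z = 0 then Re (Q z) else if Q z = 0 then 0 else 2 * sgn (Im z))"
  \<comment> \<open>The lower root evaluates at its conjugate, so a pair yields the real and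
    imaginary parts of one and the same complex number.\<close>
  define f where "f = (\<lambda>z. vec N (\<lambda>j. if Im z < 0 then Im (w (cnj z) * cnj z ^ j) else Re (w z * z ^ j)))"
  have f: "f z \<in> carrier_vec N" for z by (simp add: f_def)
  have fx: "f z \<bullet> x = (if Im z < 0 then Im (w (cnj z) * F x (cnj z)) else Re (w z * F x z))"
    if "x \<in> carrier_vec N" for x z
  proof -
    have "Re (v * F x y) = (\<Sum>j<N. Re (v * y ^ j) * x $ j)"
      and "Im (v * F x y) = (\<Sum>j<N. Im (v * y ^ j) * x $ j)" for v y
      unfolding F_def sum_distrib_left Re_sum Im_sum
      by (intro sum.cong refl; simp add: algebra_simps)+
    then show ?thesis using that by (simp add: f_def scalar_prod_def atLeast0LessThan)
  qed
  \<comment> \<open>Termwise the two sums differ for nonreal \<open>z\<close>; only their symmetrisations agree.\<close>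
  have pair: "h x z + h x (cnj z) = c z * (f z \<bullet> x)\<^sup>2 + c (cnj z) * (f (cnj z) \<bullet> x)\<^sup>2"
    if x: "x \<in> carrier_vec N" for x z
  proof -
    have hcnj: "h x (cnj z) = h x z" for z
      by (simp add: h_def Fcnj Qcnj flip: complex_cnj_power complex_cnj_mult)
    have pos: "h x z + h x (cnj z) = c z * (f z \<bullet> x)\<^sup>2 + c (cnj z) * (f (cnj z) \<bullet> x)\<^sup>2"
      if z: "Im z > 0" for z
    proof (cases "Q z = 0")
      case True
      then show ?thesis using z by (simp add: h_def c_def Qcnj)
    next
      case False
      have Re_power2: "Re (t\<^sup>2) = (Re t)\<^sup>2 - (Im t)\<^sup>2" for t
        by (simp add: power2_eq_square)
      have "Q z * (F x z)\<^sup>2 = (w z * F x z)\<^sup>2"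
        using False z by (simp add: w_def power_mult_distrib)
      then have "h x z = (Re (w z * F x z))\<^sup>2 - (Im (w z * F x z))\<^sup>2"
        by (simp only: h_def Re_power2)
      then show ?thesis
        using False z by (simp add: hcnj fx[OF x] c_def Qcnj)
    qed
    consider "Im z > 0" | "Im z = 0" | "Im (cnj z) > 0" by (cases "Im z" "0::real" rule: linorder_cases) auto
    then show ?thesis
    proof cases
      case 2
      then have "cnj z = z" by (simp add: complex_eq_iff)
      then have "Im (F x z) = 0" "Im (Q z) = 0"
        using Fcnj[of x z] Qcnj[of z] unfolding \<open>cnj z = z\<close> by (simp_all add: complex_eq_iff)
      then show ?thesis
        using 2 by (simp add: \<open>cnj z = z\<close> h_def c_def fx[OF x] w_def power2_eq_square)
    next
      case 3
      then show ?thesis using pos[of "cnj z"] by simp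
    qed (rule pos)
  qed
  have sum_cnj: "(\<Sum>z\<in>Z. g (cnj z)) = (\<Sum>z\<in>Z. g z)" for g :: "complex \<Rightarrow> real"
    by (rule sum.reindex_bij_witness[of _ cnj cnj]) (auto simp: cnjZ)
  have form': "x \<bullet> (S *\<^sub>v x) = (\<Sum>z\<in>Z. c z * (f z \<bullet> x)\<^sup>2)" if x: "x \<in> carrier_vec N" for x
  proof -
    \<comment> \<open>Conjugation permutes \<open>Z\<close>, so the symmetrized terms sum to twice
      the original sums.\<close>
    have "(\<Sum>z\<in>Z. h x z) + (\<Sum>z\<in>Z. h x z) = (\<Sum>z\<in>Z. h x z + h x (cnj z))"
      by (simp add: sum.distrib sum_cnj)
    also have "\<dots> = (\<Sum>z\<in>Z. c z * (f z \<bullet> x)\<^sup>2) + (\<Sum>z\<in>Z. c z * (f z \<bullet> x)\<^sup>2)"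
      unfolding pair[OF x] by (simp only: sum.distrib sum_cnj[of "\<lambda>z. c z * (f z \<bullet> x)\<^sup>2"])
    finally show ?thesis using form[OF x] by simp
  qed
  have inj: "x = 0\<^sub>v N" if x: "x \<in> carrier_vec N" and zero: "\<And>z. z \<in> Z \<Longrightarrow> f z \<bullet> x = 0" for x
  proof -
    have pos: "F x z = 0" if z: "z \<in> Z" "Im z > 0" for z
    proof -
      have "Re (w z * F x z) = 0" using zero[OF z(1)] z(2) by (simp add: fx[OF x])
      moreover have "Im (w z * F x z) = 0"
        using zero[of "cnj z"] z by (simp add: fx[OF x] cnjZ)
      ultimately have "w z * F x z = 0" by (simp only: complex_eq_iff zero_complex.sel)
      moreover have "w z \<noteq> 0" by (simp add: w_def)
      ultimately show ?thesis by simp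
    qed
    have F0: "F x z = 0" if z: "z \<in> Z" for z
    proof -
      consider "Im z > 0" | "Im z = 0" | "Im (cnj z) > 0" by (cases "Im z" "0::real" rule: linorder_cases) auto
      then show ?thesis
      proof cases
        case 2
        then have "cnj z = z" by (simp add: complex_eq_iff)
        then have "Im (F x z) = 0" using Fcnj[of x z] unfolding \<open>cnj z = z\<close> by (simp add: complex_eq_iff)
        then show ?thesis
          using 2 zero[OF z] by (simp add: fx[OF x] w_def complex_eq_iff)
      next
        case 3
        then have "F x (cnj z) = 0" using pos[of "cnj z"] z cnjZ by blast
        then show ?thesis by (simp add: Fcnj)
      qed (use pos z in auto)
    qed
    \<comment> \<open>\<open>P\<close> has coefficient vector \<open>x\<close>, hence degree below
      \<open>N\<close> unless it is zero, yet it vanishes at the \<open>N\<close> points of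
      \<open>Z\<close>.\<close>
    define P where "P = (\<Sum>j<N. monom (complex_of_real (x $ j)) j)"
    have coeff: "coeff P k = (if k < N then complex_of_real (x $ k) else 0)" for k
      by (simp add: P_def coeff_sum)
    have poly: "poly P z = F x z" for z
      by (simp add: P_def F_def poly_sum poly_monom mult.commute)
    have "P = 0"
    proof (rule ccontr)
      assume P: "P \<noteq> 0"
      have "card Z \<le> card {z. poly P z = 0}"
        using F0 by (intro card_mono poly_roots_finite[OF P]) (auto simp: poly)
      also have "\<dots> \<le> degree P" by (rule card_poly_roots_bound[OF P])
      also have "\<dots> < N" using P coeff by (intro degree_lessI) auto
      finally show False using cardZ by simp
    qed
    then have "x $ k = 0" if "k < N" for k
      using coeff[of k] that by simp
    then show ?thesis using x by (intro eq_vecI) auto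
  qed
  have sig: "signature S = int (card {z \<in> Z. c z > 0}) - int (card {z \<in> Z. c z < 0})"
    by (rule signature_quadratic_form[OF S finZ cardZ f inj form']; blast)
  \<comment> \<open>Both choices of \<open>R\<close> exclude 0 and ignore the factor 2, so a nonreal
    root counts only through the half-plane it lies in, and only if \<open>Q z\<close> is
    nonzero.\<close>
  have card_split: "card {z \<in> Z. R (c z)} =
      card {x. poly p x = 0 \<and> R (poly q x)} + card {z \<in> Z. Q z \<noteq> 0 \<and> Im z \<noteq> 0 \<and> R (sgn (Im z))}"
    if R: "R = (\<lambda>t. t > 0) \<or> R = (\<lambda>t. t < (0::real))" for R
  proof -
    have "{z \<in> Z. R (c z)} = complex_of_real ` {x. poly p x = 0 \<and> R (poly q x)} \<union>
        {z \<in> Z. Q z \<noteq> 0 \<and> Im z \<noteq> 0 \<and> R (sgn (Im z))}" (is "?A = ?B \<union> ?C")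
    proof (rule Set.set_eqI)
      fix z
      show "z \<in> ?A \<longleftrightarrow> z \<in> ?B \<union> ?C"
      proof (cases "Im z = 0")
        case True
        then have "z = complex_of_real (Re z)" by (simp add: complex_eq_iff)
        then obtain t where "z = complex_of_real t" by blast
        then show ?thesis by (auto simp: Z_def Q_def c_def poly_cpoly_of_real)
      next
        case False
        then show ?thesis using R by (auto simp: c_def sgn_if)
      qed
    qed
    moreover have "finite ?B"
      using finZ by (rule finite_subset[rotated]) (auto simp: Z_def poly_cpoly_of_real)
    moreover have "finite ?C" using finZ by simp
    ultimately have "card ?A = card ?B + card ?C"
      by (simp only:, intro card_Un_disjoint) auto
    also have "card ?B = card {x. poly p x = 0 \<and> R (poly q x)}"
      by (intro card_image) (simp add: inj_on_def)
    finally show ?thesis .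
  qed
  \<comment> \<open>Conjugation exchanges the half-planes, so the nonreal roots cancel in the
    signature.\<close>
  have "card {z \<in> Z. Q z \<noteq> 0 \<and> Im z \<noteq> 0 \<and> sgn (Im z) > 0} =
      card {z \<in> Z. Q z \<noteq> 0 \<and> Im z \<noteq> 0 \<and> sgn (Im z) < 0}"
    by (rule bij_betw_same_card[of cnj], rule bij_betwI[of _ _ _ cnj]) (auto simp: cnjZ Qcnj)
  then show ?thesis
    using sig card_split[of "\<lambda>t. t > 0"] card_split[of "\<lambda>t. t < 0"] by (simp add: S_def)
qed

section \<open>Excluding eigenvalues from an interval\<close>

theorem corollary2:
  fixes A :: "real mat" and n :: nat and a b :: real and p q :: "real poly"
  assumes "n \<ge> 1"
    and "A \<in> carrier_mat n n"
    and "p = char_poly A"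
    and "gcd p (pderiv p) = 1"
    and "a \<le> b"
    and "q = [:- a, 1:] * [:- b, 1:]"
    and "signature (hermite_mat q p) = signature (hermite_mat 1 p)"
  shows "\<not> (\<exists>x \<in> {a..b}. eigenvalue A x)"
proof
  assume "\<exists>x \<in> {a..b}. eigenvalue A x"
  then obtain x where x: "a \<le> x" "x \<le> b" "poly p x = 0"
    using eigenvalue_root_char_poly[OF assms(2)] assms(3) by auto
  have p: "p \<noteq> 0" using degree_monic_char_poly[OF assms(2)] assms(3) by auto
  have "poly q x = (x - a) * (x - b)" by (simp add: assms(6) algebra_simps)
  then have qx: "poly q x \<le> 0" using x by (simp add: mult_nonneg_nonpos)
  \<comment> \<open>For the constant 1 every real root counts as positive. For \<open>q\<close> the
    root \<open>x\<close> is missing from the positive count, and subtracting the negative count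
    cannot make up for it.\<close>
  have "card {x. poly p x = 0 \<and> poly q x > 0} < card {x. poly p x = 0}"
    by (rule psubset_card_mono[OF poly_roots_finite[OF p]]) (use x(3) qx in force)
  then show False using assms(7) by (simp add: signature_hermite_mat[OF p])
qed

end
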